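(* Let $\mathbb{K}$ be an algebraically closed field of characteristic $0$. Let $\mathcal{B}$ be a bialgebra over $\mathbb{K}$ and $u$ its unit. Let $\mathcal{B}'$ be the result of adjoining to $\mathcal{B}$ successive unit elements $e$ and $1$ with respect to the multiplication, with the comultiplication $\Delta$ and counit $\varepsilon$ of $\mathcal{B}$ extended linearly to $\mathcal{B}'$ by $$\Delta(1)=(1-e)\otimes(1-e)+(e-u)\otimes(e-u)+u\otimes u,\qquad \Delta(e)=(e-u)\otimes(e-u)+u\otimes u,$$ $$\varepsilon(1)=3,\qquad \varepsilon(e)=2.$$ Then $\mathcal{B}'$ is a weak bialgebra.
   Context: Adjoining successive unit elements $e$ and $1$ to $\mathcal{B}$ means: first form $\mathcal{B}\oplus\mathbb{K}e$, with the multiplication extending that of $\mathcal{B}$ for which $e$ is a unit; then form $\mathcal{B}'=\mathcal{B}\oplus\mathbb{K}e\oplus\mathbb{K}1$, with the multiplication extending that of $\mathcal{B}\oplus\mathbb{K}e$ for which $1$ is a unit. A bialgebra is assumed unital and counital, with $\Delta$ and $\varepsilon$ unital algebra morphisms. Weak bialgebra. Write $xy=m(x\otimes y)$ and use Sweedler notation $\Delta(x)=x_{(1)}\otimes x_{(2)}$ (summation understood). A weak bialgebra is a quintuple $(V,m,\eta,\Delta,\varepsilon)$ with linear maps $m:V\otimes V\to V$, $\eta:\mathbb{K}\to V$ (write $1=\eta(1)$), $\Delta:V\to V\otimes V$, $\varepsilon:V\to\mathbb{K}$ such that: (1) $(V,m,\eta)$ is a unital associative algebra; (2) $(V,\Delta,\varepsilon)$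 is a coassociative counital coalgebra; (3) for all $x,y,z\in V$: $\Delta(xy)=\Delta(x)\bullet\Delta(y)$; $(\Delta\otimes \mathrm{id})\Delta(1)=(\Delta(1)\otimes 1)\bullet(1\otimes\Delta(1))=(1\otimes\Delta(1))\bullet(\Delta(1)\otimes 1)$; and $\varepsilon(xyz)=\varepsilon(xy_{(1)})\,\varepsilon(y_{(2)}z)$. Here $\bullet$ is the usual componentwise multiplication on tensor powers of $V$. *)

theory Defs
  imports
    "HOL-Computational_Algebra.Computational_Algebra"
    "HOL-Library.Poly_Mapping"
    "HOL-Library.Product_Plus"
begin

section \<open>Free vector spaces\<close>

text \<open>The free vector space on a type 'p is the type of finitely supported functions
  from 'p to the field; the basis vector of p is \<open>Poly_Mapping.single p 1\<close>.\<close>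

definition fscale :: "'k::field \<Rightarrow> ('p \<Rightarrow>\<^sub>0 'k) \<Rightarrow> ('p \<Rightarrow>\<^sub>0 'k)" where
  "fscale c f = Poly_Mapping.map ((*) c) f"

lemma lookup_fscale [simp]:
  "Poly_Mapping.lookup (fscale c f) p = c * Poly_Mapping.lookup f p"
  by (simp add: fscale_def Poly_Mapping.map.rep_eq when_def)

interpretation free: vector_space "fscale :: 'k::field \<Rightarrow> ('p \<Rightarrow>\<^sub>0 'k) \<Rightarrow> ('p \<Rightarrow>\<^sub>0 'k)"
  by unfold_locales
    (auto intro!: poly_mapping_eqI simp: lookup_add distrib_left distrib_right)

abbreviation basis_vec :: "'p \<Rightarrow> ('p \<Rightarrow>\<^sub>0 'k::field)" where
  "basis_vec p \<equiv> Poly_Mapping.single p 1"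

text \<open>\<open>lin_ext s g\<close> is the linear extension of g from the basis to the free vector space,
  with values in the vector space with scalar multiplication s.\<close>

definition lin_ext ::
    "('k::field \<Rightarrow> 'w \<Rightarrow> 'w) \<Rightarrow> ('p \<Rightarrow> 'w::ab_group_add) \<Rightarrow> ('p \<Rightarrow>\<^sub>0 'k) \<Rightarrow> 'w" where
  "lin_ext s g f = (\<Sum>p\<in>Poly_Mapping.keys f. s (Poly_Mapping.lookup f p) (g p))"


section \<open>Tensor powers\<close>

text \<open>The tensor product of V with itself is the free vector space on pairs modulo the span of
  the bilinear relations, and the third tensor power is the free vector space on triples modulo
  the span of the trilinear relations. As these quotients depend on the scalar multiplication,
  they are not types; a tensor is a coset, that is, a set of formal linear combinations.\<close>

definition rels2 :: "('k::field \<Rightarrow> 'v::ab_group_add \<Rightarrow> 'v) \<Rightarrow> ('v \<times> 'v \<Rightarrow>\<^sub>0 'k) set" where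
  "rels2 s =
     {basis_vec (x + x', y) - basis_vec (x, y) - basis_vec (x', y) | x x' y. True} \<union>
     {basis_vec (x, y + y') - basis_vec (x, y) - basis_vec (x, y') | x y y'. True} \<union>
     {basis_vec (s c x, y) - fscale c (basis_vec (x, y)) | c x y. True} \<union>
     {basis_vec (x, s c y) - fscale c (basis_vec (x, y)) | c x y. True}"

definition rels3 :: "('k::field \<Rightarrow> 'v::ab_group_add \<Rightarrow> 'v) \<Rightarrow> ('v \<times> 'v \<times> 'v \<Rightarrow>\<^sub>0 'k) set" where
  "rels3 s =
     {basis_vec (x + x', y, z) - basis_vec (x, y, z) - basis_vec (x', y, z) | x x' y z. True} \<union>
     {basis_vec (x, y + y', z) - basis_vec (x, y, z) - basis_vec (x, y', z) | x y y' z. True} \<union>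
     {basis_vec (x, y, z + z') - basis_vec (x, y, z) - basis_vec (x, y, z') | x y z z'. True} \<union>
     {basis_vec (s c x, y, z) - fscale c (basis_vec (x, y, z)) | c x y z. True} \<union>
     {basis_vec (x, s c y, z) - fscale c (basis_vec (x, y, z)) | c x y z. True} \<union>
     {basis_vec (x, y, s c z) - fscale c (basis_vec (x, y, z)) | c x y z. True}"

definition tclass :: "('p \<Rightarrow>\<^sub>0 'k::field) set \<Rightarrow> ('p \<Rightarrow>\<^sub>0 'k) \<Rightarrow> ('p \<Rightarrow>\<^sub>0 'k) set" where
  "tclass R f = {g. g - f \<in> free.span R}"

definition tcarrier :: "('p \<Rightarrow>\<^sub>0 'k::field) set \<Rightarrow> ('p \<Rightarrow>\<^sub>0 'k) set set" where
  "tcarrier R = range (tclass R)"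

text \<open>All operations on tensors below are computed on an arbitrarily chosen representative.
  They are applied only where the result is independent of that choice, because the maps
  involved (multiplication, comultiplication, counit) are (bi)linear.\<close>

definition trep :: "('p \<Rightarrow>\<^sub>0 'k::field) set \<Rightarrow> ('p \<Rightarrow>\<^sub>0 'k)" where
  "trep T = (SOME f. f \<in> T)"

definition tadd ::
    "('p \<Rightarrow>\<^sub>0 'k::field) set \<Rightarrow> ('p \<Rightarrow>\<^sub>0 'k) set \<Rightarrow> ('p \<Rightarrow>\<^sub>0 'k) set \<Rightarrow> ('p \<Rightarrow>\<^sub>0 'k) set" where
  "tadd R T U = tclass R (trep T + trep U)"

definition tscale ::
    "('p \<Rightarrow>\<^sub>0 'k::field) set \<Rightarrow> 'k \<Rightarrow> ('p \<Rightarrow>\<^sub>0 'k) set \<Rightarrow> ('p \<Rightarrow>\<^sub>0 'k) set" where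
  "tscale R c T = tclass R (fscale c (trep T))"

definition pure2 ::
    "('k::field \<Rightarrow> 'v::ab_group_add \<Rightarrow> 'v) \<Rightarrow> 'v \<Rightarrow> 'v \<Rightarrow> ('v \<times> 'v \<Rightarrow>\<^sub>0 'k) set" where
  "pure2 s x y = tclass (rels2 s) (basis_vec (x, y))"

text \<open>The componentwise multiplications induced by a bilinear multiplication m.\<close>

definition tmult2 ::
    "('k::field \<Rightarrow> 'v::ab_group_add \<Rightarrow> 'v) \<Rightarrow> ('v \<Rightarrow> 'v \<Rightarrow> 'v) \<Rightarrow>
     ('v \<times> 'v \<Rightarrow>\<^sub>0 'k) set \<Rightarrow> ('v \<times> 'v \<Rightarrow>\<^sub>0 'k) set \<Rightarrow> ('v \<times> 'v \<Rightarrow>\<^sub>0 'k) set" where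
  "tmult2 s m T U = tclass (rels2 s)
     (lin_ext fscale (\<lambda>(x, y). lin_ext fscale (\<lambda>(x', y'). basis_vec (m x x', m y y')) (trep U))
       (trep T))"

definition tmult3 ::
    "('k::field \<Rightarrow> 'v::ab_group_add \<Rightarrow> 'v) \<Rightarrow> ('v \<Rightarrow> 'v \<Rightarrow> 'v) \<Rightarrow>
     ('v \<times> 'v \<times> 'v \<Rightarrow>\<^sub>0 'k) set \<Rightarrow> ('v \<times> 'v \<times> 'v \<Rightarrow>\<^sub>0 'k) set \<Rightarrow> ('v \<times> 'v \<times> 'v \<Rightarrow>\<^sub>0 'k) set" where
  "tmult3 s m T U = tclass (rels3 s)
     (lin_ext fscale (\<lambda>(x, y, z).
        lin_ext fscale (\<lambda>(x', y', z'). basis_vec (m x x', m y y', m z z')) (trep U))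
       (trep T))"

text \<open>For a tensor T in the second tensor power and a vector w:
  \<open>tens_right s T w\<close> is T tensor w, \<open>tens_left s w T\<close> is w tensor T.\<close>

definition tens_right ::
    "('k::field \<Rightarrow> 'v::ab_group_add \<Rightarrow> 'v) \<Rightarrow> ('v \<times> 'v \<Rightarrow>\<^sub>0 'k) set \<Rightarrow> 'v \<Rightarrow>
     ('v \<times> 'v \<times> 'v \<Rightarrow>\<^sub>0 'k) set" where
  "tens_right s T w = tclass (rels3 s) (lin_ext fscale (\<lambda>(x, y). basis_vec (x, y, w)) (trep T))"

definition tens_left ::
    "('k::field \<Rightarrow> 'v::ab_group_add \<Rightarrow> 'v) \<Rightarrow> 'v \<Rightarrow> ('v \<times> 'v \<Rightarrow>\<^sub>0 'k) set \<Rightarrow>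
     ('v \<times> 'v \<times> 'v \<Rightarrow>\<^sub>0 'k) set" where
  "tens_left s w T = tclass (rels3 s) (lin_ext fscale (\<lambda>(x, y). basis_vec (w, x, y)) (trep T))"

text \<open>\<open>comult_id s \<Delta>\<close> is \<open>\<Delta>\<close> tensor id, \<open>id_comult s \<Delta>\<close> is id tensor \<open>\<Delta>\<close>.\<close>

definition comult_id ::
    "('k::field \<Rightarrow> 'v::ab_group_add \<Rightarrow> 'v) \<Rightarrow> ('v \<Rightarrow> ('v \<times> 'v \<Rightarrow>\<^sub>0 'k) set) \<Rightarrow>
     ('v \<times> 'v \<Rightarrow>\<^sub>0 'k) set \<Rightarrow> ('v \<times> 'v \<times> 'v \<Rightarrow>\<^sub>0 'k) set" where
  "comult_id s \<Delta> T = tclass (rels3 s)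
     (lin_ext fscale (\<lambda>(x, y). trep (tens_right s (\<Delta> x) y)) (trep T))"

definition id_comult ::
    "('k::field \<Rightarrow> 'v::ab_group_add \<Rightarrow> 'v) \<Rightarrow> ('v \<Rightarrow> ('v \<times> 'v \<Rightarrow>\<^sub>0 'k) set) \<Rightarrow>
     ('v \<times> 'v \<Rightarrow>\<^sub>0 'k) set \<Rightarrow> ('v \<times> 'v \<times> 'v \<Rightarrow>\<^sub>0 'k) set" where
  "id_comult s \<Delta> T = tclass (rels3 s)
     (lin_ext fscale (\<lambda>(x, y). trep (tens_left s x (\<Delta> y))) (trep T))"

text \<open>\<open>counit_id s \<epsilon>\<close> is \<open>\<epsilon>\<close> tensor id, followed by the identification of K tensor V with V
  (respectively \<open>id_counit\<close>, on the other side).\<close>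

definition counit_id ::
    "('k::field \<Rightarrow> 'v::ab_group_add \<Rightarrow> 'v) \<Rightarrow> ('v \<Rightarrow> 'k) \<Rightarrow> ('v \<times> 'v \<Rightarrow>\<^sub>0 'k) set \<Rightarrow> 'v" where
  "counit_id s \<epsilon> T = lin_ext s (\<lambda>(x, y). s (\<epsilon> x) y) (trep T)"

definition id_counit ::
    "('k::field \<Rightarrow> 'v::ab_group_add \<Rightarrow> 'v) \<Rightarrow> ('v \<Rightarrow> 'k) \<Rightarrow> ('v \<times> 'v \<Rightarrow>\<^sub>0 'k) set \<Rightarrow> 'v" where
  "id_counit s \<epsilon> T = lin_ext s (\<lambda>(x, y). s (\<epsilon> y) x) (trep T)"

text \<open>The map f tensor f, for f a linear map into the vector space with scalar multiplication s.\<close>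

definition tmap2 ::
    "('k::field \<Rightarrow> 'w::ab_group_add \<Rightarrow> 'w) \<Rightarrow> ('v \<Rightarrow> 'w) \<Rightarrow> ('v \<times> 'v \<Rightarrow>\<^sub>0 'k) set \<Rightarrow>
     ('w \<times> 'w \<Rightarrow>\<^sub>0 'k) set" where
  "tmap2 s f T = tclass (rels2 s) (lin_ext fscale (\<lambda>(x, y). basis_vec (f x, f y)) (trep T))"


section \<open>Bialgebras and weak bialgebras\<close>

text \<open>The multiplication, a linear map on the tensor square, is given as a bilinear map, and the
  unit, a linear map from the field, by its value at 1.\<close>

locale unital_algebra = vector_space scale
  for scale :: "'k::field \<Rightarrow> 'v::ab_group_add \<Rightarrow> 'v" +
  fixes mult :: "'v \<Rightarrow> 'v \<Rightarrow> 'v" and one :: 'v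
  assumes mult_linear_right: "Vector_Spaces.linear scale scale (\<lambda>y. mult x y)"
    and mult_linear_left: "Vector_Spaces.linear scale scale (\<lambda>x. mult x y)"
    and mult_assoc: "mult (mult x y) z = mult x (mult y z)"
    and mult_one_left: "mult one x = x"
    and mult_one_right: "mult x one = x"

locale counital_coalgebra = vector_space scale
  for scale :: "'k::field \<Rightarrow> 'v::ab_group_add \<Rightarrow> 'v" +
  fixes \<Delta> :: "'v \<Rightarrow> ('v \<times> 'v \<Rightarrow>\<^sub>0 'k) set" and \<epsilon> :: "'v \<Rightarrow> 'k"
  assumes comult_carrier: "\<Delta> x \<in> tcarrier (rels2 scale)"
    and comult_add: "\<Delta> (x + y) = tadd (rels2 scale) (\<Delta> x) (\<Delta> y)"
    and comult_scale: "\<Delta> (scale c x) = tscale (rels2 scale) c (\<Delta> x)"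
    and counit_linear: "Vector_Spaces.linear scale (*) \<epsilon>"
    and coassoc: "comult_id scale \<Delta> (\<Delta> x) = id_comult scale \<Delta> (\<Delta> x)"
    and counit_left: "counit_id scale \<epsilon> (\<Delta> x) = x"
    and counit_right: "id_counit scale \<epsilon> (\<Delta> x) = x"

locale bialgebra = unital_algebra scale mult one + counital_coalgebra scale \<Delta> \<epsilon>
  for scale :: "'k::field \<Rightarrow> 'v::ab_group_add \<Rightarrow> 'v" and mult one \<Delta> \<epsilon> +
  assumes comult_mult: "\<Delta> (mult x y) = tmult2 scale mult (\<Delta> x) (\<Delta> y)"
    and comult_one: "\<Delta> one = pure2 scale one one"
    and counit_mult: "\<epsilon> (mult x y) = \<epsilon> x * \<epsilon> y"
    and counit_one: "\<epsilon> one = 1"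

locale weak_bialgebra = unital_algebra scale mult one + counital_coalgebra scale \<Delta> \<epsilon>
  for scale :: "'k::field \<Rightarrow> 'v::ab_group_add \<Rightarrow> 'v" and mult one \<Delta> \<epsilon> +
  assumes comult_mult: "\<Delta> (mult x y) = tmult2 scale mult (\<Delta> x) (\<Delta> y)"
    and weak_unit_left: "comult_id scale \<Delta> (\<Delta> one) =
      tmult3 scale mult (tens_right scale (\<Delta> one) one) (tens_left scale one (\<Delta> one))"
    and weak_unit_right: "comult_id scale \<Delta> (\<Delta> one) =
      tmult3 scale mult (tens_left scale one (\<Delta> one)) (tens_right scale (\<Delta> one) one)"
    and weak_counit: "\<epsilon> (mult (mult x y) z) =
      lin_ext (*) (\<lambda>(p, q). \<epsilon> (mult x p) * \<epsilon> (mult q z)) (trep (\<Delta> y))"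


section \<open>Adjoining unit elements\<close>

text \<open>The direct sum of an algebra A and K e is the product type; the pair (x, a) stands for
  x + a e.\<close>

definition adj_scale :: "('k::field \<Rightarrow> 'v \<Rightarrow> 'v) \<Rightarrow> 'k \<Rightarrow> 'v \<times> 'k \<Rightarrow> 'v \<times> 'k" where
  "adj_scale s c = (\<lambda>(x, a). (s c x, c * a))"

definition adj_mult ::
    "('k::field \<Rightarrow> 'v::ab_group_add \<Rightarrow> 'v) \<Rightarrow> ('v \<Rightarrow> 'v \<Rightarrow> 'v) \<Rightarrow>
     'v \<times> 'k \<Rightarrow> 'v \<times> 'k \<Rightarrow> 'v \<times> 'k" where
  "adj_mult s m = (\<lambda>(x, a) (y, b). (m x y + s a y + s b x, a * b))"

definition adj_unit :: "'v::ab_group_add \<times> 'k::field" where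
  "adj_unit = (0, 1)"

definition adj_incl :: "'v \<Rightarrow> 'v \<times> 'k::field" where
  "adj_incl x = (x, 0)"

type_synonym ('v, 'k) adj2 = "('v \<times> 'k) \<times> 'k"

definition scale' :: "('k::field \<Rightarrow> 'v \<Rightarrow> 'v) \<Rightarrow> 'k \<Rightarrow> ('v, 'k) adj2 \<Rightarrow> ('v, 'k) adj2" where
  "scale' s = adj_scale (adj_scale s)"

definition mult' ::
    "('k::field \<Rightarrow> 'v::ab_group_add \<Rightarrow> 'v) \<Rightarrow> ('v \<Rightarrow> 'v \<Rightarrow> 'v) \<Rightarrow>
     ('v, 'k) adj2 \<Rightarrow> ('v, 'k) adj2 \<Rightarrow> ('v, 'k) adj2" where
  "mult' s m = adj_mult (adj_scale s) (adj_mult s m)"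

definition one' :: "('v::ab_group_add, 'k::field) adj2" where
  "one' = adj_unit"

definition e' :: "('v::ab_group_add, 'k::field) adj2" where
  "e' = adj_incl adj_unit"

definition incl' :: "'v \<Rightarrow> ('v, 'k::field) adj2" where
  "incl' b = adj_incl (adj_incl b)"

definition comult_e ::
    "('k::field \<Rightarrow> 'v::ab_group_add \<Rightarrow> 'v) \<Rightarrow> 'v \<Rightarrow>
     (('v, 'k) adj2 \<times> ('v, 'k) adj2 \<Rightarrow>\<^sub>0 'k) set" where
  "comult_e s u = tadd (rels2 (scale' s))
     (pure2 (scale' s) (e' - incl' u) (e' - incl' u))
     (pure2 (scale' s) (incl' u) (incl' u))"

definition comult_one ::
    "('k::field \<Rightarrow> 'v::ab_group_add \<Rightarrow> 'v) \<Rightarrow> 'v \<Rightarrow>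
     (('v, 'k) adj2 \<times> ('v, 'k) adj2 \<Rightarrow>\<^sub>0 'k) set" where
  "comult_one s u = tadd (rels2 (scale' s))
     (tadd (rels2 (scale' s))
       (pure2 (scale' s) (one' - e') (one' - e'))
       (pure2 (scale' s) (e' - incl' u) (e' - incl' u)))
     (pure2 (scale' s) (incl' u) (incl' u))"

text \<open>The element ((b, a), c) is b + a e + c 1.\<close>

definition comult' ::
    "('k::field \<Rightarrow> 'v::ab_group_add \<Rightarrow> 'v) \<Rightarrow> 'v \<Rightarrow> ('v \<Rightarrow> ('v \<times> 'v \<Rightarrow>\<^sub>0 'k) set) \<Rightarrow>
     ('v, 'k) adj2 \<Rightarrow> (('v, 'k) adj2 \<times> ('v, 'k) adj2 \<Rightarrow>\<^sub>0 'k) set" where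
  "comult' s u \<Delta> = (\<lambda>((b, a), c). tadd (rels2 (scale' s))
     (tadd (rels2 (scale' s))
       (tmap2 (scale' s) incl' (\<Delta> b))
       (tscale (rels2 (scale' s)) a (comult_e s u)))
     (tscale (rels2 (scale' s)) c (comult_one s u)))"

definition counit' :: "('v \<Rightarrow> 'k::field) \<Rightarrow> ('v, 'k) adj2 \<Rightarrow> 'k" where
  "counit' \<epsilon> = (\<lambda>((b, a), c). \<epsilon> b + a * 2 + c * 3)"


section \<open>The extended comultiplication and counit have the prescribed values\<close>

lemma tclass_eq_iff: "tclass R f = tclass R g \<longleftrightarrow> f - g \<in> free.span R"
proof
  assume "tclass R f = tclass R g"
  moreover have "f \<in> tclass R f" by (simp add: tclass_def free.span_zero)
  ultimately show "f - g \<in> free.span R" by (auto simp: tclass_def)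
next
  assume *: "f - g \<in> free.span R"
  have "h - f \<in> free.span R \<longleftrightarrow> h - g \<in> free.span R" for h
    using free.span_add[of "h - f" R "f - g"] free.span_diff[of "h - g" R "f - g"] * by auto
  then show "tclass R f = tclass R g" by (auto simp: tclass_def)
qed

lemma trep_tclass: "trep (tclass R f) - f \<in> free.span R"
proof -
  have "f \<in> tclass R f" by (simp add: tclass_def free.span_zero)
  then have "trep (tclass R f) \<in> tclass R f" unfolding trep_def by (rule someI)
  then show ?thesis by (simp add: tclass_def)
qed

lemma tadd_tclass: "tadd R (tclass R f) (tclass R g) = tclass R (f + g)"
  using free.span_add[OF trep_tclass[of R f] trep_tclass[of R g]]
  by (simp add: tadd_def tclass_eq_iff algebra_simps)

lemma tscale_tclass: "tscale R c (tclass R f) = tclass R (fscale c f)"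
  using free.span_scale[OF trep_tclass[of R f], of c]
  by (simp add: tscale_def tclass_eq_iff free.scale_right_diff_distrib)

lemma (in vector_space) linear_lin_ext: "Vector_Spaces.linear fscale scale (lin_ext scale g)"
proof -
  have ext: "lin_ext scale g f = (\<Sum>p\<in>A. scale (Poly_Mapping.lookup f p) (g p))"
    if "finite A" "Poly_Mapping.keys f \<subseteq> A" for f A
    unfolding lin_ext_def using that by (intro sum.mono_neutral_left) (auto simp: in_keys_iff)
  have add: "lin_ext scale g (f + h) = lin_ext scale g f + lin_ext scale g h" for f h
  proof -
    let ?A = "Poly_Mapping.keys f \<union> Poly_Mapping.keys h"
    have "Poly_Mapping.keys (f + h) \<subseteq> ?A" by (rule keys_add)
    then show ?thesis
      by (simp add: ext[of ?A] lookup_add scale_left_distrib sum.distrib)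
  qed
  have scl: "lin_ext scale g (fscale c f) = scale c (lin_ext scale g f)" for c f
  proof -
    have "Poly_Mapping.keys (fscale c f) \<subseteq> Poly_Mapping.keys f" by (auto simp: in_keys_iff)
    then show ?thesis
      by (simp add: ext[of "Poly_Mapping.keys f"] scale_sum_right)
  qed
  show ?thesis
    by unfold_locales (auto simp: add scl)
qed

lemma (in vector_space) lin_ext_basis_vec: "lin_ext scale g (basis_vec p) = g p"
  by (simp add: lin_ext_def)

lemma tmap2_tclass:
  assumes f: "Vector_Spaces.linear s s' f"
  shows "tmap2 s' f (tclass (rels2 s) t) =
    tclass (rels2 s') (lin_ext fscale (\<lambda>(x, y). basis_vec (f x, f y)) t)"
proof -
  interpret f: Vector_Spaces.linear s s' f by fact
  let ?L = "lin_ext fscale (\<lambda>(x, y). basis_vec (f x, f y))"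
  interpret L: Vector_Spaces.linear fscale fscale ?L
    by (rule free.linear_lin_ext)
  note L_simps = L.diff L.scale free.lin_ext_basis_vec f.add f.scale
  have "?L ` rels2 s \<subseteq> rels2 s'"
    unfolding rels2_def by (auto simp: L_simps; blast)
  then have "?L ` free.span (rels2 s) \<subseteq> free.span (rels2 s')"
    by (metis L.span_image free.span_mono)
  moreover have "?L (trep (tclass (rels2 s) t)) - ?L t = ?L (trep (tclass (rels2 s) t) - t)"
    by (simp add: L.diff)
  ultimately show ?thesis
    using trep_tclass[of "rels2 s" t] by (auto simp: tmap2_def tclass_eq_iff)
qed

lemma vector_space_adj_scale: "vector_space s \<Longrightarrow> vector_space (adj_scale s)"
  unfolding vector_space_def adj_scale_def by (auto simp: algebra_simps)

lemma linear_incl':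
  assumes "vector_space s"
  shows "Vector_Spaces.linear s (scale' s) incl'"
proof -
  interpret s: vector_space s by fact
  interpret s': vector_space "scale' s"
    unfolding scale'_def by (intro vector_space_adj_scale assms)
  show ?thesis
    by unfold_locales (auto simp: incl'_def adj_incl_def scale'_def adj_scale_def)
qed

context counital_coalgebra
begin

lemma comult'_add: "comult' scale u \<Delta> (x + y) =
    tadd (rels2 (scale' scale)) (comult' scale u \<Delta> x) (comult' scale u \<Delta> y)"
  and comult'_scale: "comult' scale u \<Delta> (scale' scale k x) =
    tscale (rels2 (scale' scale)) k (comult' scale u \<Delta> x)"
  and comult'_incl: "comult' scale u \<Delta> (incl' b) = tmap2 (scale' scale) incl' (\<Delta> b)"
  and comult'_e: "comult' scale u \<Delta> e' = comult_e scale u"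
  and comult'_one: "comult' scale u \<Delta> one' = comult_one scale u"
proof -
  let ?R = "rels2 scale" and ?R' = "rels2 (scale' scale)"
  let ?L = "lin_ext fscale (\<lambda>(x, y). basis_vec (incl' x :: ('v, 'k) adj2, incl' y) :: _ \<Rightarrow>\<^sub>0 'k)"
  interpret L: Vector_Spaces.linear fscale fscale ?L
    by (rule free.linear_lin_ext)
  have lin: "Vector_Spaces.linear scale (scale' scale) (incl' :: 'v \<Rightarrow> ('v, 'k) adj2)"
    by (rule linear_incl') unfold_locales
  have "\<exists>d. \<forall>x. \<Delta> x = tclass ?R (d x)"
    using comult_carrier by (intro choice) (auto simp: tcarrier_def)
  then obtain d where d: "\<And>x. \<Delta> x = tclass ?R (d x)" by auto
  obtain q where q: "comult_e scale u = tclass ?R' q"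
    by (auto simp: comult_e_def tadd_def)
  obtain r where r: "comult_one scale u = tclass ?R' r"
    by (auto simp: comult_one_def tadd_def)
  have val: "comult' scale u \<Delta> ((b, a), c) =
      tclass ?R' (?L (d b) + fscale a q + fscale c r)" for a b c
    by (simp add: comult'_def d q r tmap2_tclass[OF lin] tscale_tclass tadd_tclass)
  have Lw: "tclass ?R' (?L f + h) = tclass ?R' (?L g + h)" if "tclass ?R f = tclass ?R g" for f g h
  proof -
    have "tclass ?R' (?L f) = tclass ?R' (?L g)"
      using that tmap2_tclass[OF lin, of f] tmap2_tclass[OF lin, of g] by simp
    then show ?thesis by (simp add: tclass_eq_iff)
  qed
  have dadd: "tclass ?R (d (x + y)) = tclass ?R (d x + d y)" for x y
    using comult_add[of x y] by (simp add: d tadd_tclass)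
  have dscale: "tclass ?R (d (scale k x)) = tclass ?R (fscale k (d x))" for k x
    using comult_scale[of k x] by (simp add: d tscale_tclass)
  show "comult' scale u \<Delta> (x + y) =
      tadd ?R' (comult' scale u \<Delta> x) (comult' scale u \<Delta> y)"
  proof -
    obtain b a c b2 a2 c2 where [simp]: "x = ((b, a), c)" "y = ((b2, a2), c2)"
      by (metis surj_pair)
    have "comult' scale u \<Delta> (x + y) =
        tclass ?R' (?L (d (b + b2)) + (fscale (a + a2) q + fscale (c + c2) r))"
      by (simp add: val add.assoc)
    also have "\<dots> = tclass ?R' (?L (d b + d b2) + (fscale (a + a2) q + fscale (c + c2) r))"
      by (rule Lw, rule dadd)
    also have "\<dots> = tadd ?R' (comult' scale u \<Delta> x) (comult' scale u \<Delta> y)"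
      by (simp add: val tadd_tclass L.add free.scale_left_distrib algebra_simps)
    finally show ?thesis .
  qed
  show "comult' scale u \<Delta> (scale' scale k x) = tscale ?R' k (comult' scale u \<Delta> x)"
  proof -
    obtain b a c where [simp]: "x = ((b, a), c)"
      by (metis surj_pair)
    have "comult' scale u \<Delta> (scale' scale k x) =
        tclass ?R' (?L (d (scale k b)) + (fscale (k * a) q + fscale (k * c) r))"
      by (simp add: val scale'_def adj_scale_def add.assoc)
    also have "\<dots> = tclass ?R' (?L (fscale k (d b)) + (fscale (k * a) q + fscale (k * c) r))"
      by (rule Lw, rule dscale)
    also have "\<dots> = tscale ?R' k (comult' scale u \<Delta> x)"
      by (simp add: val tscale_tclass L.scale free.scale_right_distrib add.assoc)
    finally show ?thesis .
  qed
  have d0: "tclass ?R (d 0) = tclass ?R 0"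
    using dscale[of 0 0] by simp
  show "comult' scale u \<Delta> (incl' b) = tmap2 (scale' scale) incl' (\<Delta> b)"
    by (simp add: incl'_def[of b] adj_incl_def val d tmap2_tclass[OF lin])
  show "comult' scale u \<Delta> e' = comult_e scale u"
    using Lw[OF d0, of q] by (simp add: e'_def adj_incl_def adj_unit_def val q L.zero)
  show "comult' scale u \<Delta> one' = comult_one scale u"
    using Lw[OF d0, of r] by (simp add: one'_def adj_unit_def val r L.zero zero_prod_def)
qed

end

lemma counit'_simps:
  assumes "Vector_Spaces.linear s (*) \<epsilon>"
  shows "counit' \<epsilon> (incl' b) = \<epsilon> b" "counit' \<epsilon> e' = 2" "counit' \<epsilon> one' = 3"
  using Vector_Spaces.linear.axioms(3)[OF assms, THEN module_hom.zero]
  by (simp_all add: counit'_def incl'_def e'_def one'_def adj_incl_def adj_unit_def zero_prod_def)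

end

theory Submission
  imports Defs
begin

text \<open>
  The reason is a splitting. Let \<open>A\<close> be a weak bialgebra with unit \<open>u\<close>, adjoin a unit element
  \<open>e\<close>, and put \<open>f = e - u\<close>. Then \<open>f\<close> is idempotent and annihilates \<open>A\<close>, so \<open>A \<oplus> K e\<close> is, as an
  algebra, the direct product of \<open>A\<close> and \<open>K f\<close>. If the comultiplication is extended by
  \<open>\<Delta> e = f \<otimes> f + \<Delta> u\<close> and the counit by \<open>\<epsilon> e = 1 + \<epsilon> u\<close>, then \<open>f\<close> is group-like, that is,
  \<open>\<Delta> f = f \<otimes> f\<close> and \<open>\<epsilon> f = 1\<close>, and the coalgebra is the direct sum of \<open>A\<close> and \<open>K f\<close> as well.
  Every axiom of a weak bialgebra holds on each of the two summands, and all mixed terms vanish.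
  Thus \<open>A \<oplus> K e\<close> is again a weak bialgebra (\<open>weak_bialgebra_adj\<close>). The extension described in
  the theorem is this construction carried out twice (\<open>comult'_eq_adj_comult\<close>,
  \<open>counit'_eq_adj_counit\<close>), starting from a bialgebra, which is a weak bialgebra
  (\<open>bialgebra_is_weak\<close>): since \<open>\<epsilon> u = 1\<close>, the counit takes the values 2 and 3 on the two new
  units.

  Tensors are cosets, and the operations on them are computed on chosen representatives. To
  calculate with them, they are tested against multilinear forms: two tensors are equal as soon
  as all bilinear (respectively trilinear) forms with values in the field agree on them
  (\<open>tensor2_eqI\<close>, \<open>tensor3_eqI\<close>). The value of a form on the result of a tensor operation is an
  iterated pairing with the arguments, so every identity becomes the computation that one writes
  in Sweedler notation. All those concerning the adjoined unit rest on one formula: with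
  \<open>p (x + a e) = x + a u\<close> the projection onto \<open>A\<close>,
  \<open>\<langle>\<Delta> X, \<beta>\<rangle> = \<langle>\<Delta> (p X), \<beta>\<rangle> + a \<beta>(f, f)\<close> for \<open>X = x + a e\<close> (\<open>pairing_adj\<close>).
\<close>


section \<open>Linear extensions\<close>

lemma vector_space_field: "vector_space ((*) :: 'k::field \<Rightarrow> 'k \<Rightarrow> 'k)"
  by unfold_locales (auto simp: algebra_simps)

lemma lin_ext_basis_vec_id: "lin_ext fscale basis_vec f = f"
proof (rule poly_mapping_eqI)
  fix p
  have "Poly_Mapping.lookup (lin_ext fscale basis_vec f) p =
      (\<Sum>q\<in>Poly_Mapping.keys f. if q = p then Poly_Mapping.lookup f q else 0)"
    unfolding lin_ext_def lookup_sum by (intro sum.cong) (auto simp: lookup_single)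
  also have "\<dots> = Poly_Mapping.lookup f p"
    by (auto simp: in_keys_iff)
  finally show "Poly_Mapping.lookup (lin_ext fscale basis_vec f) p = Poly_Mapping.lookup f p" .
qed

lemma linear_lin_ext_commute:
  assumes "Vector_Spaces.linear s s' h"
  shows "h (lin_ext s g f) = lin_ext s' (\<lambda>p. h (g p)) f"
proof -
  interpret h: Vector_Spaces.linear s s' h by fact
  show ?thesis by (simp add: lin_ext_def h.sum h.scale)
qed

lemma lin_ext_lin_ext:
  assumes "vector_space s"
  shows "lin_ext s g (lin_ext fscale h f) = lin_ext s (\<lambda>p. lin_ext s g (h p)) f"
  by (rule linear_lin_ext_commute) (rule vector_space.linear_lin_ext[OF assms])

text \<open>A vector outside a subspace is detected by a linear functional that vanishes on that
  subspace. Hence a coset is determined by the values on it of the functions on the basis whose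
  linear extensions kill the relations.\<close>

lemma tclass_eqI:
  fixes f g :: "'p \<Rightarrow>\<^sub>0 'k::field"
  assumes eq: "\<And>\<beta> :: 'p \<Rightarrow> 'k. (\<And>r. r \<in> R \<Longrightarrow> lin_ext (*) \<beta> r = 0) \<Longrightarrow>
    lin_ext (*) \<beta> f = lin_ext (*) \<beta> g"
  shows "tclass R f = tclass R g"
proof (rule ccontr)
  interpret K: vector_space "(*) :: 'k \<Rightarrow> 'k \<Rightarrow> 'k" by (rule vector_space_field)
  interpret P: vector_space_pair "fscale :: 'k \<Rightarrow> ('p \<Rightarrow>\<^sub>0 'k) \<Rightarrow> _" "(*) :: 'k \<Rightarrow> 'k \<Rightarrow> 'k" ..
  assume "tclass R f \<noteq> tclass R g"
  then have v: "f - g \<notin> free.span R" by (simp add: tclass_eq_iff)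
  obtain B where B: "B \<subseteq> R" "free.independent B" "R \<subseteq> free.span B"
    using free.maximal_independent_subset by blast
  have "f - g \<notin> free.span B" using v free.span_mono[OF B(1)] by blast
  then have ind: "free.independent (insert (f - g) B)" and vB: "f - g \<notin> B"
    using B(2) free.independent_insertI free.span_base by blast+
  obtain h where h: "Vector_Spaces.linear fscale (*) h"
    and hB: "\<forall>x\<in>insert (f - g) B. h x = (if x = f - g then 1 else 0)"
    using P.linear_independent_extend[OF ind, of "\<lambda>x. if x = f - g then 1 else 0"] by blast
  interpret h: Vector_Spaces.linear fscale "(*)" h by (rule h)
  have ext: "lin_ext (*) (\<lambda>p. h (basis_vec p)) t = h t" for t
    using linear_lin_ext_commute[OF h, of basis_vec t] by (simp add: lin_ext_basis_vec_id)
  have "h r = 0" if "r \<in> R" for r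
  proof -
    have "h b = 0" if "b \<in> B" for b using that hB vB by auto
    moreover have "r \<in> free.span B" using that B(3) by blast
    ultimately show ?thesis by (rule P.linear_eq_0_on_span[OF h])
  qed
  then have "h f = h g" using eq[of "\<lambda>p. h (basis_vec p)"] by (simp add: ext)
  then show False using hB h.diff[of f g] by simp
qed


section \<open>Pairing tensors with multilinear maps\<close>

definition bilin ::
    "('k::field \<Rightarrow> 'v::ab_group_add \<Rightarrow> 'v) \<Rightarrow> ('k \<Rightarrow> 'w::ab_group_add \<Rightarrow> 'w) \<Rightarrow>
     ('v \<Rightarrow> 'v \<Rightarrow> 'w) \<Rightarrow> bool" where
  "bilin s s' \<beta> \<longleftrightarrow>
     (\<forall>x x' y. \<beta> (x + x') y = \<beta> x y + \<beta> x' y) \<and> (\<forall>x y y'. \<beta> x (y + y') = \<beta> x y + \<beta> x y') \<and>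
     (\<forall>c x y. \<beta> (s c x) y = s' c (\<beta> x y)) \<and> (\<forall>c x y. \<beta> x (s c y) = s' c (\<beta> x y))"

definition trilin ::
    "('k::field \<Rightarrow> 'v::ab_group_add \<Rightarrow> 'v) \<Rightarrow> ('k \<Rightarrow> 'w::ab_group_add \<Rightarrow> 'w) \<Rightarrow>
     ('v \<Rightarrow> 'v \<Rightarrow> 'v \<Rightarrow> 'w) \<Rightarrow> bool" where
  "trilin s s' \<beta> \<longleftrightarrow> (\<forall>x. bilin s s' (\<beta> x)) \<and> (\<forall>y. bilin s s' (\<lambda>x z. \<beta> x y z))"

lemma bilinI:
  assumes "\<And>x x' y. \<beta> (x + x') y = \<beta> x y + \<beta> x' y" "\<And>x y y'. \<beta> x (y + y') = \<beta> x y + \<beta> x y'"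
    "\<And>c x y. \<beta> (s c x) y = s' c (\<beta> x y)" "\<And>c x y. \<beta> x (s c y) = s' c (\<beta> x y)"
  shows "bilin s s' \<beta>"
  using assms unfolding bilin_def by blast

lemma trilinI:
  assumes "\<And>x x' y z. \<beta> (x + x') y z = \<beta> x y z + \<beta> x' y z"
    "\<And>x y y' z. \<beta> x (y + y') z = \<beta> x y z + \<beta> x y' z"
    "\<And>x y z z'. \<beta> x y (z + z') = \<beta> x y z + \<beta> x y z'"
    "\<And>c x y z. \<beta> (s c x) y z = s' c (\<beta> x y z)"
    "\<And>c x y z. \<beta> x (s c y) z = s' c (\<beta> x y z)"
    "\<And>c x y z. \<beta> x y (s c z) = s' c (\<beta> x y z)"
  shows "trilin s s' \<beta>"
  unfolding trilin_def bilin_def by (intro conjI allI assms)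

text \<open>The rules are equations between functions, so that they also rewrite a partially applied
  map: \<open>\<lambda>(p, q). \<beta> x p q\<close> is \<open>case_prod (\<beta> x)\<close> up to eta conversion.\<close>

lemma bilinD:
  assumes "bilin s s' \<beta>"
  shows "\<beta> (x + x') = (\<lambda>y. \<beta> x y + \<beta> x' y)" "\<beta> x (y + y') = \<beta> x y + \<beta> x y'"
    "\<beta> (s c x) = (\<lambda>y. s' c (\<beta> x y))" "\<beta> x (s c y) = s' c (\<beta> x y)"
  using assms by (auto simp: bilin_def)

lemma bilin_zero:
  assumes "bilin s s' \<beta>"
  shows "\<beta> 0 = (\<lambda>y. 0)" "\<beta> x 0 = 0"
proof -
  have "\<beta> 0 y = 0" for y using bilinD(1)[OF assms, of 0 0] by (metis add_cancel_right_right)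
  then show "\<beta> 0 = (\<lambda>y. 0)" by blast
  show "\<beta> x 0 = 0" using bilinD(2)[OF assms, of x 0 0] by simp
qed

lemma trilinD:
  assumes "trilin s s' \<beta>"
  shows "\<beta> (x + x') = (\<lambda>y z. \<beta> x y z + \<beta> x' y z)"
    "\<beta> x (y + y') = (\<lambda>z. \<beta> x y z + \<beta> x y' z)"
    "\<beta> x y (z + z') = \<beta> x y z + \<beta> x y z'"
    "\<beta> (s c x) = (\<lambda>y z. s' c (\<beta> x y z))"
    "\<beta> x (s c y) = (\<lambda>z. s' c (\<beta> x y z))"
    "\<beta> x y (s c z) = s' c (\<beta> x y z)"
  using assms by (auto simp: bilin_def trilin_def fun_eq_iff)

lemma bilin_slice:
  assumes "trilin s s' \<beta>"
  shows "bilin s s' (\<lambda>x y. \<beta> x y z)" "bilin s s' (\<beta> x)"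
  using assms by (auto simp: bilin_def trilin_def)

lemma trilin_zero:
  assumes "trilin s s' \<beta>"
  shows "\<beta> x 0 z = 0"
  using bilin_zero(1)[OF bilin_slice(2)[OF assms]] by simp

text \<open>Paired with a bilinear \<open>\<beta>\<close>, the tensor \<open>\<Delta> x\<close> gives what Sweedler notation writes as
  \<open>\<beta>(x\<^sub>(\<^sub>1\<^sub>), x\<^sub>(\<^sub>2\<^sub>))\<close>.\<close>

definition pairing ::
    "('k::field \<Rightarrow> 'w::ab_group_add \<Rightarrow> 'w) \<Rightarrow> ('p \<Rightarrow> 'w) \<Rightarrow> ('p \<Rightarrow>\<^sub>0 'k) set \<Rightarrow> 'w" where
  "pairing s \<beta> T = lin_ext s \<beta> (trep T)"

lemma lin_ext_rels2:
  assumes "vector_space s'" "bilin s s' \<beta>" "r \<in> rels2 s"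
  shows "lin_ext s' (case_prod \<beta>) r = 0"
proof -
  interpret s': vector_space s' by fact
  interpret L: Vector_Spaces.linear fscale s' "lin_ext s' (case_prod \<beta>)"
    by (rule s'.linear_lin_ext)
  show ?thesis
    using assms(3) unfolding rels2_def
    by (auto simp: L.diff L.scale s'.lin_ext_basis_vec bilinD[OF assms(2)])
qed

lemma lin_ext_rels3:
  assumes "vector_space s'" "trilin s s' \<beta>" "r \<in> rels3 s"
  shows "lin_ext s' (\<lambda>(x, y, z). \<beta> x y z) r = 0"
proof -
  interpret s': vector_space s' by fact
  interpret L: Vector_Spaces.linear fscale s' "lin_ext s' (\<lambda>(x, y, z). \<beta> x y z)"
    by (rule s'.linear_lin_ext)
  show ?thesis
    using assms(3) unfolding rels3_def
    by (auto simp: L.diff L.scale s'.lin_ext_basis_vec trilinD[OF assms(2)])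
qed

text \<open>The pairing does not see the choice of representative when \<open>\<beta>\<close> respects the relations.\<close>

lemma pairing_tclass:
  assumes "vector_space s" "\<And>r. r \<in> R \<Longrightarrow> lin_ext s \<beta> r = 0"
  shows "pairing s \<beta> (tclass R f) = lin_ext s \<beta> f"
proof -
  interpret s: vector_space s by fact
  interpret P: vector_space_pair "fscale :: 'a \<Rightarrow> ('c \<Rightarrow>\<^sub>0 'a) \<Rightarrow> _" s ..
  interpret L: Vector_Spaces.linear fscale s "lin_ext s \<beta>" by (rule s.linear_lin_ext)
  have "lin_ext s \<beta> (trep (tclass R f) - f) = 0"
    using P.linear_eq_0_on_span[OF s.linear_lin_ext assms(2) trep_tclass] .
  then show ?thesis by (simp add: pairing_def L.diff)
qed

lemmas pairing_tclass2 = pairing_tclass[OF _ lin_ext_rels2]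
lemmas pairing_tclass3 = pairing_tclass[OF _ lin_ext_rels3]

text \<open>A function on the basis of pairs whose linear extension kills the bilinear relations is a
  bilinear form; this turns the general criterion for equality of cosets into a test by bilinear
  forms, and likewise for triples.\<close>

lemma tensor2_eqI:
  fixes s :: "'k::field \<Rightarrow> 'v::ab_group_add \<Rightarrow> 'v"
  assumes "T \<in> tcarrier (rels2 s)" "U \<in> tcarrier (rels2 s)"
    and eq: "\<And>\<beta>. bilin s (*) \<beta> \<Longrightarrow> pairing (*) (case_prod \<beta>) T = pairing (*) (case_prod \<beta>) U"
  shows "T = U"
proof -
  interpret K: vector_space "(*) :: 'k \<Rightarrow> 'k \<Rightarrow> 'k" by (rule vector_space_field)
  obtain f g where [simp]: "T = tclass (rels2 s) f" "U = tclass (rels2 s) g"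
    using assms(1,2) by (auto simp: tcarrier_def)
  have "tclass (rels2 s) f = tclass (rels2 s) g"
  proof (rule tclass_eqI)
    fix \<beta> :: "'v \<times> 'v \<Rightarrow> 'k" assume 0: "\<And>r. r \<in> rels2 s \<Longrightarrow> lin_ext (*) \<beta> r = 0"
    interpret L: Vector_Spaces.linear fscale "(*)" "lin_ext (*) \<beta>" by (rule K.linear_lin_ext)
    have "basis_vec (x + x', y) - basis_vec (x, y) - basis_vec (x', y) \<in> rels2 s"
      "basis_vec (x, y + y') - basis_vec (x, y) - basis_vec (x, y') \<in> rels2 s"
      "basis_vec (s c x, y) - fscale c (basis_vec (x, y)) \<in> rels2 s"
      "basis_vec (x, s c y) - fscale c (basis_vec (x, y)) \<in> rels2 s" for x x' y y' c
      unfolding rels2_def by blast+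
    from this[THEN 0] have "bilin s (*) (\<lambda>x y. \<beta> (x, y))"
      unfolding bilin_def by (simp add: L.add L.diff L.scale K.lin_ext_basis_vec algebra_simps)
    from eq[OF this] show "lin_ext (*) \<beta> f = lin_ext (*) \<beta> g"
      by (simp add: pairing_tclass[OF vector_space_field 0])
  qed
  then show ?thesis by simp
qed

lemma tensor3_eqI:
  fixes s :: "'k::field \<Rightarrow> 'v::ab_group_add \<Rightarrow> 'v"
  assumes "T \<in> tcarrier (rels3 s)" "U \<in> tcarrier (rels3 s)"
    and eq: "\<And>\<beta>. trilin s (*) \<beta> \<Longrightarrow>
      pairing (*) (\<lambda>(x, y, z). \<beta> x y z) T = pairing (*) (\<lambda>(x, y, z). \<beta> x y z) U"
  shows "T = U"
proof -
  interpret K: vector_space "(*) :: 'k \<Rightarrow> 'k \<Rightarrow> 'k" by (rule vector_space_field)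
  obtain f g where [simp]: "T = tclass (rels3 s) f" "U = tclass (rels3 s) g"
    using assms(1,2) by (auto simp: tcarrier_def)
  have "tclass (rels3 s) f = tclass (rels3 s) g"
  proof (rule tclass_eqI)
    fix \<beta> :: "'v \<times> 'v \<times> 'v \<Rightarrow> 'k" assume 0: "\<And>r. r \<in> rels3 s \<Longrightarrow> lin_ext (*) \<beta> r = 0"
    interpret L: Vector_Spaces.linear fscale "(*)" "lin_ext (*) \<beta>" by (rule K.linear_lin_ext)
    have rels: "basis_vec (x + x', y, z) - basis_vec (x, y, z) - basis_vec (x', y, z) \<in> rels3 s"
      "basis_vec (x, y + y', z) - basis_vec (x, y, z) - basis_vec (x, y', z) \<in> rels3 s"
      "basis_vec (x, y, z + z') - basis_vec (x, y, z) - basis_vec (x, y, z') \<in> rels3 s"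
      "basis_vec (s c x, y, z) - fscale c (basis_vec (x, y, z)) \<in> rels3 s"
      "basis_vec (x, s c y, z) - fscale c (basis_vec (x, y, z)) \<in> rels3 s"
      "basis_vec (x, y, s c z) - fscale c (basis_vec (x, y, z)) \<in> rels3 s" for x x' y y' z z' c
      unfolding rels3_def
      (* one family of relations after the other, in the order of the union *)
      subgoal by (rule UnI1, rule UnI1, rule UnI1, rule UnI1, rule UnI1, blast)
      subgoal by (rule UnI1, rule UnI1, rule UnI1, rule UnI1, rule UnI2, blast)
      subgoal by (rule UnI1, rule UnI1, rule UnI1, rule UnI2, blast)
      subgoal by (rule UnI1, rule UnI1, rule UnI2, blast)
      subgoal by (rule UnI1, rule UnI2, blast)
      subgoal by (rule UnI2, blast)
      done
    from rels[THEN 0] have "trilin s (*) (\<lambda>x y z. \<beta> (x, y, z))"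
      unfolding trilin_def bilin_def
      by (simp add: L.add L.diff L.scale K.lin_ext_basis_vec algebra_simps)
    from eq[OF this] show "lin_ext (*) \<beta> f = lin_ext (*) \<beta> g"
      by (simp add: pairing_tclass[OF vector_space_field 0])
  qed
  then show ?thesis by simp
qed

lemma in_tcarrier [simp]:
  "tclass R f \<in> tcarrier R" "tadd R T U \<in> tcarrier R" "tscale R c T \<in> tcarrier R"
  "pure2 s x y \<in> tcarrier (rels2 s)" "tmult2 s m T' U' \<in> tcarrier (rels2 s)"
  "tmap2 s i V' \<in> tcarrier (rels2 s)"
  "tmult3 s m T'' U'' \<in> tcarrier (rels3 s)" "tens_right s T' x \<in> tcarrier (rels3 s)"
  "tens_left s x T' \<in> tcarrier (rels3 s)" "comult_id s \<Delta> T' \<in> tcarrier (rels3 s)"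
  "id_comult s \<Delta> T' \<in> tcarrier (rels3 s)"
  by (auto simp: tcarrier_def tadd_def tscale_def pure2_def tmult2_def tmap2_def tmult3_def
      tens_right_def tens_left_def comult_id_def id_comult_def)

context
  fixes s' :: "'k::field \<Rightarrow> 'w::ab_group_add \<Rightarrow> 'w"
  assumes vs: "vector_space s'"
begin

interpretation s': vector_space s' by (rule vs)

lemma pairing_add_right:
  "pairing s' (\<lambda>(x, y). g x y + h x y) T =
    pairing s' (\<lambda>(x, y). g x y) T + pairing s' (\<lambda>(x, y). h x y) T"
  by (simp add: pairing_def lin_ext_def case_prod_unfold s'.scale_right_distrib sum.distrib)

lemma pairing_scale_right:
  "pairing s' (\<lambda>(x, y). s' c (g x y)) T = s' c (pairing s' (\<lambda>(x, y). g x y) T)"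
  by (simp add: pairing_def lin_ext_def case_prod_unfold s'.scale_sum_right mult.commute)

lemma pairing_zero_right: "pairing s' (\<lambda>(x, y). 0) T = 0"
  by (simp add: pairing_def lin_ext_def case_prod_unfold)

context
  fixes s :: "'k \<Rightarrow> 'v::ab_group_add \<Rightarrow> 'v" and \<beta> :: "'v \<Rightarrow> 'v \<Rightarrow> 'w"
  assumes \<beta>: "bilin s s' \<beta>"
begin

interpretation L: Vector_Spaces.linear fscale s' "lin_ext s' (case_prod \<beta>)"
  by (rule s'.linear_lin_ext)

text \<open>The operations on tensors work on the representatives chosen for their arguments, and the
  pairings on the right-hand sides below refer to these same representatives. Hence \<open>\<beta>\<close> is the
  only map that has to be multilinear.\<close>

lemma pairing_pure2: "pairing s' (case_prod \<beta>) (pure2 s x y) = \<beta> x y"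
  by (simp add: pure2_def pairing_tclass2[OF vs vs \<beta>] s'.lin_ext_basis_vec)

lemma pairing_tadd:
  "pairing s' (case_prod \<beta>) (tadd (rels2 s) T U) =
    pairing s' (case_prod \<beta>) T + pairing s' (case_prod \<beta>) U"
  by (simp add: tadd_def pairing_tclass2[OF vs vs \<beta>] L.add) (simp add: pairing_def)

lemma pairing_tscale:
  "pairing s' (case_prod \<beta>) (tscale (rels2 s) c T) = s' c (pairing s' (case_prod \<beta>) T)"
  by (simp add: tscale_def pairing_tclass2[OF vs vs \<beta>] L.scale) (simp add: pairing_def)

lemma pairing_tmult2:
  "pairing s' (case_prod \<beta>) (tmult2 s m T U) =
    pairing s' (\<lambda>(x, y). pairing s' (\<lambda>(x', y'). \<beta> (m x x') (m y y')) U) T"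
  by (simp add: tmult2_def pairing_tclass2[OF vs vs \<beta>] lin_ext_lin_ext[OF vs])
    (simp add: pairing_def case_prod_unfold lin_ext_lin_ext[OF vs] s'.lin_ext_basis_vec)

lemma pairing_tmap2:
  "pairing s' (case_prod \<beta>) (tmap2 s i T) = pairing s' (\<lambda>(x, y). \<beta> (i x) (i y)) T"
  by (simp add: tmap2_def pairing_tclass2[OF vs vs \<beta>] lin_ext_lin_ext[OF vs])
    (simp add: pairing_def case_prod_unfold s'.lin_ext_basis_vec)

end

context
  fixes s :: "'k \<Rightarrow> 'v::ab_group_add \<Rightarrow> 'v" and \<beta> :: "'v \<Rightarrow> 'v \<Rightarrow> 'v \<Rightarrow> 'w"
  assumes \<beta>: "trilin s s' \<beta>"
begin

lemma pairing_tmult3: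
  "pairing s' (\<lambda>(x, y, z). \<beta> x y z) (tmult3 s m T U) =
    pairing s' (\<lambda>(x, y, z). pairing s' (\<lambda>(x', y', z'). \<beta> (m x x') (m y y') (m z z')) U) T"
  by (simp add: tmult3_def pairing_tclass3[OF vs vs \<beta>] lin_ext_lin_ext[OF vs])
    (simp add: pairing_def case_prod_unfold lin_ext_lin_ext[OF vs] s'.lin_ext_basis_vec)

lemma pairing_tens_right:
  "pairing s' (\<lambda>(x, y, z). \<beta> x y z) (tens_right s T w) = pairing s' (\<lambda>(x, y). \<beta> x y w) T"
  by (simp add: tens_right_def pairing_tclass3[OF vs vs \<beta>] lin_ext_lin_ext[OF vs])
    (simp add: pairing_def case_prod_unfold s'.lin_ext_basis_vec)

lemma pairing_tens_left:
  "pairing s' (\<lambda>(x, y, z). \<beta> x y z) (tens_left s w T) = pairing s' (\<lambda>(x, y). \<beta> w x y) T"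
  by (simp add: tens_left_def pairing_tclass3[OF vs vs \<beta>] lin_ext_lin_ext[OF vs])
    (simp add: pairing_def case_prod_unfold s'.lin_ext_basis_vec)

end

lemma pairing_comult_id:
  assumes \<beta>: "trilin s s' \<beta>"
  shows "pairing s' (\<lambda>(x, y, z). \<beta> x y z) (comult_id s \<Delta> T) =
    pairing s' (\<lambda>(x, y). pairing s' (\<lambda>(p, q). \<beta> p q y) (\<Delta> x)) T"
  using pairing_tens_right[OF \<beta>]
  by (simp add: comult_id_def pairing_tclass3[OF vs vs \<beta>] lin_ext_lin_ext[OF vs])
    (simp add: pairing_def case_prod_unfold)

lemma pairing_id_comult:
  assumes \<beta>: "trilin s s' \<beta>"
  shows "pairing s' (\<lambda>(x, y, z). \<beta> x y z) (id_comult s \<Delta> T) =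
    pairing s' (\<lambda>(x, y). pairing s' (\<lambda>(p, q). \<beta> x p q) (\<Delta> y)) T"
  using pairing_tens_left[OF \<beta>]
  by (simp add: id_comult_def pairing_tclass3[OF vs vs \<beta>] lin_ext_lin_ext[OF vs])
    (simp add: pairing_def case_prod_unfold)

end


section \<open>Linear comultiplications\<close>

text \<open>Linearity of \<open>\<Delta>\<close> is all that is needed to calculate with iterated comultiplications. It is
  separated from the coalgebra axioms because those of an extended comultiplication are
  themselves proved by such calculations.\<close>

locale linear_comult = vector_space scale
  for scale :: "'k::field \<Rightarrow> 'v::ab_group_add \<Rightarrow> 'v" +
  fixes \<Delta> :: "'v \<Rightarrow> ('v \<times> 'v \<Rightarrow>\<^sub>0 'k) set"
  assumes comult_add: "\<Delta> (x + y) = tadd (rels2 scale) (\<Delta> x) (\<Delta> y)"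
    and comult_scale: "\<Delta> (scale c x) = tscale (rels2 scale) c (\<Delta> x)"
begin

context
  fixes s' :: "'k \<Rightarrow> 'w::ab_group_add \<Rightarrow> 'w"
  assumes vs: "vector_space s'"
begin

interpretation s': vector_space s' by (rule vs)

lemma
  assumes "bilin scale s' \<beta>"
  shows pairing_comult_add: "pairing s' (\<lambda>(p, q). \<beta> p q) (\<Delta> (x + y)) =
      pairing s' (\<lambda>(p, q). \<beta> p q) (\<Delta> x) + pairing s' (\<lambda>(p, q). \<beta> p q) (\<Delta> y)"
    and pairing_comult_scale: "pairing s' (\<lambda>(p, q). \<beta> p q) (\<Delta> (scale c x)) =
      s' c (pairing s' (\<lambda>(p, q). \<beta> p q) (\<Delta> x))"
  by (simp_all add: comult_add comult_scale pairing_tadd[OF vs assms] pairing_tscale[OF vs assms])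

lemma pairing_comult_zero:
  assumes "bilin scale s' \<beta>"
  shows "pairing s' (\<lambda>(p, q). \<beta> p q) (\<Delta> 0) = 0"
  using pairing_comult_scale[OF assms, of 0 0] by simp

text \<open>Iterated comultiplications are paired from the outside in. The inner pairing has to be
  known to be bilinear in the remaining variables before the rules for the outer one apply.\<close>

lemma bilin_pairing_comult:
  assumes "trilin scale s' \<beta>"
  shows "bilin scale s' (\<lambda>x y. pairing s' (\<lambda>(p, q). \<beta> p q y) (\<Delta> x))"
    and "bilin scale s' (\<lambda>x y. pairing s' (\<lambda>(p, q). \<beta> x p q) (\<Delta> y))"
  by (rule bilinI; simp add: pairing_comult_add pairing_comult_scale bilin_slice[OF assms]
      trilinD[OF assms] pairing_add_right[OF vs] pairing_scale_right[OF vs])+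

end

end

sublocale counital_coalgebra \<subseteq> linear_comult scale \<Delta>
  by unfold_locales (rule comult_add comult_scale)+

context counital_coalgebra
begin

lemma counit_eqs: "\<epsilon> (x + y) = \<epsilon> x + \<epsilon> y" "\<epsilon> (scale c x) = c * \<epsilon> x"
  using Vector_Spaces.linear.axioms(3)[OF counit_linear]
  by (auto simp: module_hom.add module_hom.scale)

lemma counit_zero: "\<epsilon> 0 = 0"
  using counit_eqs(2)[of 0 0] by simp

end

context unital_algebra
begin

lemma mult_eqs:
  "mult (x + x') y = mult x y + mult x' y" "mult x (y + y') = mult x y + mult x y'"
  "mult (scale c x) y = scale c (mult x y)" "mult x (scale c y) = scale c (mult x y)"
  using module_hom.add[OF Vector_Spaces.linear.axioms(3)[OF mult_linear_left[of y]], of x x']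
    module_hom.add[OF Vector_Spaces.linear.axioms(3)[OF mult_linear_right[of x]], of y y']
    module_hom.scale[OF Vector_Spaces.linear.axioms(3)[OF mult_linear_left[of y]], of c x]
    module_hom.scale[OF Vector_Spaces.linear.axioms(3)[OF mult_linear_right[of x]], of c y]
  by simp_all

lemma mult_zero: "mult 0 y = 0" "mult x 0 = 0"
  using mult_eqs(3)[of 0 0 y] mult_eqs(4)[of x 0 0] by simp_all

lemma mult_minus: "mult (- x) y = - mult x y" "mult x (- y) = - mult x y"
  using mult_eqs(3)[of "- 1" x y] mult_eqs(4)[of x "- 1" y] by simp_all

context
  fixes s' :: "'k \<Rightarrow> 'w::ab_group_add \<Rightarrow> 'w" and \<beta> :: "'v \<Rightarrow> 'v \<Rightarrow> 'v \<Rightarrow> 'w"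
  assumes vs: "vector_space s'" and \<beta>: "trilin scale s' \<beta>"
begin

text \<open>The two triple products in the axiom for \<open>\<Delta> 1\<close> are
  \<open>1\<^sub>(\<^sub>1\<^sub>) \<otimes> 1\<^sub>(\<^sub>2\<^sub>) 1'\<^sub>(\<^sub>1\<^sub>) \<otimes> 1'\<^sub>(\<^sub>2\<^sub>)\<close> and \<open>1'\<^sub>(\<^sub>1\<^sub>) \<otimes> 1\<^sub>(\<^sub>1\<^sub>) 1'\<^sub>(\<^sub>2\<^sub>) \<otimes> 1\<^sub>(\<^sub>2\<^sub>)\<close>, where the outer
  factors have absorbed the units (\<open>pairing_tens_right_left\<close>, \<open>pairing_tens_left_right\<close>). The
  facts on bilinearity allow both copies of \<open>\<Delta> 1\<close> to be evaluated in turn.\<close>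

lemma bilin_weak_unit_left:
  "bilin scale s' (\<lambda>x' y'. \<beta> x (mult y x') y')"
  "bilin scale s' (\<lambda>x y. pairing s' (\<lambda>(x', y'). \<beta> x (mult y x') y') T)"
  by (rule bilinI; simp add: mult_eqs trilinD[OF \<beta>] pairing_add_right[OF vs]
      pairing_scale_right[OF vs])+

lemma bilin_weak_unit_right:
  "bilin scale s' (\<lambda>x' y'. \<beta> x' (mult x y') y)"
  "bilin scale s' (\<lambda>x y. pairing s' (\<lambda>(x', y'). \<beta> x' (mult x y') y) T)"
  by (rule bilinI; simp add: mult_eqs trilinD[OF \<beta>] pairing_add_right[OF vs]
      pairing_scale_right[OF vs])+

lemma trilin_mult: "trilin scale s' (\<lambda>x' y' z'. \<beta> (mult x x') (mult y y') (mult z z'))"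
  by (rule trilinI) (simp_all add: mult_eqs trilinD[OF \<beta>])

lemma pairing_tens_right_left:
  "pairing s' (\<lambda>(x, y, z). \<beta> x y z)
      (tmult3 scale mult (tens_right scale T one) (tens_left scale one U)) =
    pairing s' (\<lambda>(x, y). pairing s' (\<lambda>(x', y'). \<beta> x (mult y x') y') U) T"
proof -
  have "trilin scale s' (\<lambda>x y z. pairing s' (\<lambda>(x', y'). \<beta> x (mult y x') (mult z y')) U)"
    by (rule trilinI) (simp_all add: mult_eqs trilinD[OF \<beta>] pairing_add_right[OF vs]
        pairing_scale_right[OF vs])
  from pairing_tens_right[OF vs this] show ?thesis
    by (simp add: pairing_tmult3[OF vs \<beta>] pairing_tens_left[OF vs trilin_mult]
        mult_one_left mult_one_right)
qed

lemma pairing_tens_left_right: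
  "pairing s' (\<lambda>(x, y, z). \<beta> x y z)
      (tmult3 scale mult (tens_left scale one T) (tens_right scale U one)) =
    pairing s' (\<lambda>(x, y). pairing s' (\<lambda>(x', y'). \<beta> x' (mult x y') y) U) T"
proof -
  have "trilin scale s' (\<lambda>x y z. pairing s' (\<lambda>(x', y'). \<beta> (mult x x') (mult y y') z) U)"
    by (rule trilinI) (simp_all add: mult_eqs trilinD[OF \<beta>] pairing_add_right[OF vs]
        pairing_scale_right[OF vs])
  from pairing_tens_left[OF vs this] show ?thesis
    by (simp add: pairing_tmult3[OF vs \<beta>] pairing_tens_right[OF vs trilin_mult]
        mult_one_left mult_one_right)
qed

end

end


section \<open>Adjoining a unit element to a weak bialgebra\<close>

definition adj_idem :: "'v::ab_group_add \<Rightarrow> 'v \<times> 'k::field" where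
  "adj_idem u = adj_unit - adj_incl u"

text \<open>The value at the new unit is \<open>f \<otimes> f + \<Delta> u\<close>, which makes \<open>f = e - u\<close> group-like.\<close>

definition adj_comult ::
    "('k::field \<Rightarrow> 'v::ab_group_add \<Rightarrow> 'v) \<Rightarrow> 'v \<Rightarrow> ('v \<Rightarrow> ('v \<times> 'v \<Rightarrow>\<^sub>0 'k) set) \<Rightarrow>
     'v \<times> 'k \<Rightarrow> (('v \<times> 'k) \<times> ('v \<times> 'k) \<Rightarrow>\<^sub>0 'k) set" where
  "adj_comult s u \<Delta> = (\<lambda>(x, a). tadd (rels2 (adj_scale s))
     (tmap2 (adj_scale s) adj_incl (\<Delta> x))
     (tscale (rels2 (adj_scale s)) a
       (tadd (rels2 (adj_scale s))
         (pure2 (adj_scale s) (adj_idem u) (adj_idem u))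
         (tmap2 (adj_scale s) adj_incl (\<Delta> u)))))"

text \<open>The value \<open>1 + \<epsilon> u\<close> at the new unit is the one for which \<open>\<epsilon> f = 1\<close>.\<close>

definition adj_counit :: "('v \<Rightarrow> 'k::field) \<Rightarrow> 'v \<Rightarrow> 'v \<times> 'k \<Rightarrow> 'k" where
  "adj_counit \<epsilon> u = (\<lambda>(x, a). \<epsilon> x + a * (1 + \<epsilon> u))"

lemma adj_incl_eqs:
  "adj_incl (x + y) = adj_incl x + adj_incl y" "adj_incl (s c x) = adj_scale s c (adj_incl x)"
  by (simp_all add: adj_incl_def adj_scale_def)

lemma bilin_incl:
  "bilin (adj_scale s) s' \<beta> \<Longrightarrow> bilin s s' (\<lambda>x y. \<beta> (adj_incl x) (adj_incl y))"
  by (rule bilinI) (simp_all add: adj_incl_eqs bilinD)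

lemma trilin_incl:
  "trilin (adj_scale s) s' \<beta> \<Longrightarrow>
    trilin s s' (\<lambda>x y z. \<beta> (adj_incl x) (adj_incl y) (adj_incl z))"
  by (rule trilinI) (simp_all add: adj_incl_eqs trilinD)

lemma pairing_adj_comult:
  assumes "vector_space s'" "bilin (adj_scale s) s' \<beta>"
  shows "pairing s' (\<lambda>(p, q). \<beta> p q) (adj_comult s u \<Delta> (x, a)) =
    pairing s' (\<lambda>(p, q). \<beta> (adj_incl p) (adj_incl q)) (\<Delta> x) +
    s' a (\<beta> (adj_idem u) (adj_idem u) +
      pairing s' (\<lambda>(p, q). \<beta> (adj_incl p) (adj_incl q)) (\<Delta> u))"
  by (simp add: adj_comult_def pairing_tadd[OF assms] pairing_tscale[OF assms]
      pairing_tmap2[OF assms] pairing_pure2[OF assms])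

context weak_bialgebra
begin

text \<open>In the comments below, \<open>A\<close> is the given weak bialgebra, \<open>u\<close> its unit, \<open>e\<close> the adjoined
  unit and \<open>f = e - u\<close>.\<close>

abbreviation "S \<equiv> adj_scale scale"
abbreviation "M \<equiv> adj_mult scale mult"
abbreviation "D \<equiv> adj_comult scale one \<Delta>"
abbreviation "E \<equiv> adj_counit \<epsilon> one"
abbreviation i :: "'v \<Rightarrow> 'v \<times> 'k" where "i \<equiv> adj_incl"
abbreviation f :: "'v \<times> 'k" where "f \<equiv> adj_idem one"

text \<open>The algebra morphism \<open>x + a e \<mapsto> x + a u\<close>, the projection along \<open>K f\<close>. Together with the
  coefficient of \<open>e\<close> it gives the coordinates for the splitting into \<open>A\<close> and \<open>K f\<close>.\<close>

definition adj_proj :: "'v \<times> 'k \<Rightarrow> 'v" where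
  "adj_proj X = fst X + scale (snd X) one"

lemmas adj_defs = adj_scale_def adj_mult_def adj_incl_def adj_idem_def adj_unit_def adj_proj_def

lemma adj_decomp: "X = i (adj_proj X) + S (snd X) f"
  by (cases X) (simp add: adj_defs scale_right_diff_distrib)

lemma adj_proj_eqs:
  "adj_proj (X + Y) = adj_proj X + adj_proj Y" "adj_proj (S c X) = scale c (adj_proj X)"
  "adj_proj (M X Y) = mult (adj_proj X) (adj_proj Y)"
  "adj_proj (i x) = x" "adj_proj f = 0" "adj_proj adj_unit = one"
  by (auto simp: adj_defs case_prod_unfold algebra_simps scale_right_distrib scale_left_distrib
      mult_eqs mult_one_left mult_one_right)

lemma adj_snd_eqs:
  "snd (X + Y) = snd X + snd Y" "snd (S c X) = c * snd X" "snd (M X Y) = snd X * snd Y"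
  "snd (i x) = 0" "snd f = 1" "snd adj_unit = 1"
  by (auto simp: adj_defs case_prod_unfold)

lemma adj_mult_eqs:
  "M (i x) (i y) = i (mult x y)" "M (i x) f = 0" "M f (i x) = 0" "M f f = f"
  by (auto simp: adj_defs zero_prod_def mult_eqs mult_one_left mult_one_right
      mult_zero mult_minus)

lemma adj_counit_eq: "E X = \<epsilon> (adj_proj X) + snd X"
  by (cases X) (simp add: adj_counit_def adj_proj_def counit_eqs algebra_simps)

lemma unital_algebra_adj: "unital_algebra S M adj_unit"
proof -
  interpret S: vector_space S by (rule vector_space_adj_scale) unfold_locales
  note simps = adj_defs case_prod_unfold mult_eqs mult_zero mult_assoc scale_right_distrib
    scale_left_distrib mult.commute
  show ?thesis
  proof (intro unital_algebra.intro unital_algebra_axioms.intro S.vector_space_axioms)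
    show "M (M X Y) Z = M X (M Y Z)" for X Y Z
      by (simp add: simps algebra_simps)
    show "Vector_Spaces.linear S S (\<lambda>Y. M X Y)" "Vector_Spaces.linear S S (\<lambda>X. M X Y)" for X Y
      by (unfold_locales; simp add: simps algebra_simps)+
  qed (simp_all add: simps)
qed

interpretation S: unital_algebra S M adj_unit by (rule unital_algebra_adj)

context
  fixes s' :: "'k \<Rightarrow> 'w::ab_group_add \<Rightarrow> 'w"
  assumes vs: "vector_space s'"
begin

interpretation s': vector_space s' by (rule vs)

text \<open>The comultiplication is the direct sum of that of \<open>A\<close> and of \<open>f \<mapsto> f \<otimes> f\<close>: write
  \<open>x + a e = (x + a u) + a f\<close> and use that \<open>\<Delta>\<close> is linear.\<close>

lemma pairing_adj:
  assumes "bilin S s' \<beta>"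
  shows "pairing s' (\<lambda>(p, q). \<beta> p q) (D X) =
    pairing s' (\<lambda>(p, q). \<beta> (i p) (i q)) (\<Delta> (adj_proj X)) + s' (snd X) (\<beta> f f)"
  by (cases X)
    (simp add: adj_proj_def pairing_adj_comult[OF vs assms] s'.scale_right_distrib
      pairing_comult_add[OF vs bilin_incl[OF assms]]
      pairing_comult_scale[OF vs bilin_incl[OF assms]])

lemma pairing_adj_incl:
  assumes "bilin S s' \<beta>"
  shows "pairing s' (\<lambda>(p, q). \<beta> p q) (D (i x)) = pairing s' (\<lambda>(p, q). \<beta> (i p) (i q)) (\<Delta> x)"
  by (simp add: pairing_adj[OF assms] adj_proj_eqs adj_snd_eqs)

lemma pairing_adj_idem:
  assumes "bilin S s' \<beta>"
  shows "pairing s' (\<lambda>(p, q). \<beta> p q) (D f) = \<beta> f f"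
  by (simp add: pairing_adj[OF assms] adj_proj_eqs adj_snd_eqs
      pairing_comult_zero[OF vs bilin_incl[OF assms]])

lemma pairing_adj_unit:
  assumes "bilin S s' \<beta>"
  shows "pairing s' (\<lambda>(p, q). \<beta> p q) (D adj_unit) =
    pairing s' (\<lambda>(p, q). \<beta> (i p) (i q)) (\<Delta> one) + \<beta> f f"
  by (simp add: pairing_adj[OF assms] adj_proj_eqs adj_snd_eqs)

end

lemmas vsK = vector_space_field[where 'k = 'k]

lemma adj_comult_carrier: "D X \<in> tcarrier (rels2 S)"
  by (simp add: adj_comult_def case_prod_unfold)

lemma linear_comult_adj: "linear_comult S D"
proof unfold_locales
  show "D (X + Y) = tadd (rels2 S) (D X) (D Y)" for X Y
  proof (rule tensor2_eqI[of _ S])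
    fix \<beta> :: "_ \<Rightarrow> _ \<Rightarrow> 'k" assume \<beta>: "bilin S (*) \<beta>"
    show "pairing (*) (\<lambda>(x, y). \<beta> x y) (D (X + Y)) =
        pairing (*) (\<lambda>(x, y). \<beta> x y) (tadd (rels2 S) (D X) (D Y))"
      unfolding pairing_tadd[OF vsK \<beta>] pairing_adj[OF vsK \<beta>] adj_proj_eqs adj_snd_eqs
        pairing_comult_add[OF vsK bilin_incl[OF \<beta>]]
      by (simp add: algebra_simps)
  qed (simp_all add: adj_comult_carrier)
  show "D (S c X) = tscale (rels2 S) c (D X)" for X c
  proof (rule tensor2_eqI[of _ S])
    fix \<beta> :: "_ \<Rightarrow> _ \<Rightarrow> 'k" assume \<beta>: "bilin S (*) \<beta>"
    show "pairing (*) (\<lambda>(x, y). \<beta> x y) (D (S c X)) =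
        pairing (*) (\<lambda>(x, y). \<beta> x y) (tscale (rels2 S) c (D X))"
      unfolding pairing_tscale[OF vsK \<beta>] pairing_adj[OF vsK \<beta>] adj_proj_eqs adj_snd_eqs
        pairing_comult_scale[OF vsK bilin_incl[OF \<beta>]]
      by (simp add: algebra_simps)
  qed (simp_all add: adj_comult_carrier)
qed

interpretation D: linear_comult S D by (rule linear_comult_adj)

text \<open>On the summand \<open>A\<close> this is coassociativity of \<open>A\<close>, tested by the restricted form; on \<open>f\<close>
  both sides give \<open>\<beta>(f, f, f)\<close>.\<close>

lemma adj_coassoc: "comult_id S D (D X) = id_comult S D (D X)"
proof (rule tensor3_eqI[of _ S])
  fix \<beta> :: "_ \<Rightarrow> _ \<Rightarrow> _ \<Rightarrow> 'k" assume \<beta>: "trilin S (*) \<beta>"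
  note simps = pairing_adj[OF vsK D.bilin_pairing_comult(1)[OF vsK \<beta>]]
    pairing_adj[OF vsK D.bilin_pairing_comult(2)[OF vsK \<beta>]]
    pairing_adj_incl[OF vsK bilin_slice(1)[OF \<beta>]] pairing_adj_incl[OF vsK bilin_slice(2)[OF \<beta>]]
    pairing_adj_idem[OF vsK bilin_slice(1)[OF \<beta>]] pairing_adj_idem[OF vsK bilin_slice(2)[OF \<beta>]]
  note \<beta>i = trilin_incl[OF \<beta>]
  show "pairing (*) (\<lambda>(x, y, z). \<beta> x y z) (comult_id S D (D X)) =
      pairing (*) (\<lambda>(x, y, z). \<beta> x y z) (id_comult S D (D X))"
    unfolding pairing_comult_id[OF vsK \<beta>] pairing_id_comult[OF vsK \<beta>] simps
    using arg_cong[OF coassoc, of "pairing (*) (\<lambda>(x, y, z). \<beta> (i x) (i y) (i z))" "adj_proj X"]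
    unfolding pairing_comult_id[OF vsK \<beta>i] pairing_id_comult[OF vsK \<beta>i] by simp
qed simp_all

lemma adj_counit_eqs: "E (X + Y) = E X + E Y" "E (S c X) = c * E X"
  by (simp_all add: adj_counit_eq adj_proj_eqs adj_snd_eqs counit_eqs algebra_simps)

lemma adj_incl_pairing:
  "i (pairing scale (\<lambda>(p, q). g p q) T) = pairing S (\<lambda>(p, q). i (g p q)) T"
proof -
  have "Vector_Spaces.linear scale S i"
    by unfold_locales (simp_all add: adj_incl_eqs)
  from linear_lin_ext_commute[OF this] show ?thesis
    by (simp add: pairing_def case_prod_unfold)
qed

text \<open>The counit axioms are equations in the vector space itself, so the forms to pair with take
  values there: \<open>(p, q) \<mapsto> \<epsilon>(p) q\<close> and \<open>(p, q) \<mapsto> \<epsilon>(q) p\<close>.\<close>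

lemma adj_counit_left: "counit_id S E (D X) = X"
proof -
  have "bilin S S (\<lambda>p q. S (E p) q)"
    by (rule bilinI) (simp_all add: adj_counit_eqs S.scale_left_distrib S.scale_right_distrib
        mult.commute)
  from pairing_adj[OF S.vector_space_axioms this, of X]
  have "counit_id S E (D X) =
      pairing S (\<lambda>(p, q). i (scale (\<epsilon> p) q)) (\<Delta> (adj_proj X)) + S (snd X) f"
    by (simp add: counit_id_def pairing_def adj_counit_eq adj_proj_eqs adj_snd_eqs adj_incl_eqs
        counit_zero)
  also have "\<dots> = i (counit_id scale \<epsilon> (\<Delta> (adj_proj X))) + S (snd X) f"
    unfolding adj_incl_pairing[symmetric] by (simp add: counit_id_def pairing_def)
  finally show ?thesis
    by (simp add: counit_left adj_decomp[symmetric])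
qed

lemma adj_counit_right: "id_counit S E (D X) = X"
proof -
  have "bilin S S (\<lambda>p q. S (E q) p)"
    by (rule bilinI) (simp_all add: adj_counit_eqs S.scale_left_distrib S.scale_right_distrib
        mult.commute)
  from pairing_adj[OF S.vector_space_axioms this, of X]
  have "id_counit S E (D X) =
      pairing S (\<lambda>(p, q). i (scale (\<epsilon> q) p)) (\<Delta> (adj_proj X)) + S (snd X) f"
    by (simp add: id_counit_def pairing_def adj_counit_eq adj_proj_eqs adj_snd_eqs adj_incl_eqs
        counit_zero)
  also have "\<dots> = i (id_counit scale \<epsilon> (\<Delta> (adj_proj X))) + S (snd X) f"
    unfolding adj_incl_pairing[symmetric] by (simp add: id_counit_def pairing_def)
  finally show ?thesis
    by (simp add: counit_right adj_decomp[symmetric])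
qed

text \<open>The mixed terms contain a factor \<open>x f\<close> or \<open>f x\<close> with \<open>x\<close> in \<open>A\<close>, hence vanish. The outer
  pairing is evaluated first: only then are the arguments of the products known to be \<open>f\<close> or to
  lie in \<open>A\<close>.\<close>

lemma adj_comult_mult: "D (M X Y) = tmult2 S M (D X) (D Y)"
proof (rule tensor2_eqI[of _ S])
  fix \<beta> :: "_ \<Rightarrow> _ \<Rightarrow> 'k" assume \<beta>: "bilin S (*) \<beta>"
  note \<beta>i = bilin_incl[OF \<beta>]
  have inner: "bilin S (*) (\<lambda>x' y'. \<beta> (M x x') (M y y'))" for x y
    by (rule bilinI) (simp_all add: S.mult_eqs bilinD[OF \<beta>])
  have outer: "bilin S (*) (\<lambda>x y. pairing (*) (\<lambda>(x', y'). \<beta> (M x x') (M y y')) T)" for T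
    by (rule bilinI) (simp_all add: S.mult_eqs bilinD[OF \<beta>] pairing_add_right[OF vsK]
        pairing_scale_right[OF vsK])
  show "pairing (*) (\<lambda>(x, y). \<beta> x y) (D (M X Y)) =
      pairing (*) (\<lambda>(x, y). \<beta> x y) (tmult2 S M (D X) (D Y))"
    unfolding pairing_tmult2[OF vsK \<beta>] pairing_adj[OF vsK outer]
    by (simp add: pairing_adj[OF vsK inner] pairing_adj[OF vsK \<beta>] adj_mult_eqs adj_proj_eqs
        adj_snd_eqs bilin_zero[OF \<beta>] pairing_zero_right[OF vsK] comult_mult pairing_tmult2[OF vsK \<beta>i])
qed (simp_all add: adj_comult_carrier)

text \<open>Here \<open>\<Delta> e = \<Delta> u + f \<otimes> f\<close>. In the product of two copies of it, in either order, the middle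
  tensor factor kills the mixed terms; what remains on both sides is the corresponding tensor for
  \<open>\<Delta> u\<close> plus \<open>f \<otimes> f \<otimes> f\<close>.\<close>

lemma adj_weak_unit_left: "comult_id S D (D adj_unit) =
    tmult3 S M (tens_right S (D adj_unit) adj_unit) (tens_left S adj_unit (D adj_unit))"
proof (rule tensor3_eqI[of _ S])
  fix \<beta> :: "_ \<Rightarrow> _ \<Rightarrow> _ \<Rightarrow> 'k" assume \<beta>: "trilin S (*) \<beta>"
  note \<beta>i = trilin_incl[OF \<beta>]
  note simps = pairing_adj_unit[OF vsK D.bilin_pairing_comult(1)[OF vsK \<beta>]]
    pairing_adj_incl[OF vsK bilin_slice(1)[OF \<beta>]] pairing_adj_idem[OF vsK bilin_slice(1)[OF \<beta>]]
  note inner = S.bilin_weak_unit_left(1)[OF vsK \<beta>]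
    and outer = S.bilin_weak_unit_left(2)[OF vsK \<beta>]
  show "pairing (*) (\<lambda>(x, y, z). \<beta> x y z) (comult_id S D (D adj_unit)) =
      pairing (*) (\<lambda>(x, y, z). \<beta> x y z)
        (tmult3 S M (tens_right S (D adj_unit) adj_unit) (tens_left S adj_unit (D adj_unit)))"
    unfolding S.pairing_tens_right_left[OF vsK \<beta>] pairing_adj_unit[OF vsK outer]
    using arg_cong[OF weak_unit_left, of "pairing (*) (\<lambda>(x, y, z). \<beta> (i x) (i y) (i z))"]
    by (simp add: pairing_comult_id[OF vsK \<beta>] pairing_comult_id[OF vsK \<beta>i] simps
        pairing_tens_right_left[OF vsK \<beta>i]
        pairing_adj_unit[OF vsK inner] adj_mult_eqs
        trilin_zero[OF \<beta>] pairing_zero_right[OF vsK])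
qed simp_all

lemma adj_weak_unit_right: "comult_id S D (D adj_unit) =
    tmult3 S M (tens_left S adj_unit (D adj_unit)) (tens_right S (D adj_unit) adj_unit)"
proof (rule tensor3_eqI[of _ S])
  fix \<beta> :: "_ \<Rightarrow> _ \<Rightarrow> _ \<Rightarrow> 'k" assume \<beta>: "trilin S (*) \<beta>"
  note \<beta>i = trilin_incl[OF \<beta>]
  note simps = pairing_adj_unit[OF vsK D.bilin_pairing_comult(1)[OF vsK \<beta>]]
    pairing_adj_incl[OF vsK bilin_slice(1)[OF \<beta>]] pairing_adj_idem[OF vsK bilin_slice(1)[OF \<beta>]]
  note inner = S.bilin_weak_unit_right(1)[OF vsK \<beta>]
    and outer = S.bilin_weak_unit_right(2)[OF vsK \<beta>]
  show "pairing (*) (\<lambda>(x, y, z). \<beta> x y z) (comult_id S D (D adj_unit)) =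
      pairing (*) (\<lambda>(x, y, z). \<beta> x y z)
        (tmult3 S M (tens_left S adj_unit (D adj_unit)) (tens_right S (D adj_unit) adj_unit))"
    unfolding S.pairing_tens_left_right[OF vsK \<beta>] pairing_adj_unit[OF vsK outer]
    using arg_cong[OF weak_unit_right, of "pairing (*) (\<lambda>(x, y, z). \<beta> (i x) (i y) (i z))"]
    by (simp add: pairing_comult_id[OF vsK \<beta>] pairing_comult_id[OF vsK \<beta>i] simps
        pairing_tens_left_right[OF vsK \<beta>i]
        pairing_adj_unit[OF vsK inner] adj_mult_eqs
        trilin_zero[OF \<beta>] pairing_zero_right[OF vsK])
qed simp_all

text \<open>On \<open>f\<close> the right-hand side contributes the product of the coefficients of \<open>e\<close> in \<open>X\<close>, \<open>Y\<close>
  and \<open>Z\<close>, and this product is the coefficient of \<open>e\<close> in \<open>X Y Z\<close>.\<close>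

lemma adj_weak_counit: "E (M (M X Y) Z) =
    lin_ext (*) (\<lambda>(p, q). E (M X p) * E (M q Z)) (trep (D Y))"
proof -
  have "bilin S (*) (\<lambda>p q. E (M X p) * E (M q Z))"
    by (rule bilinI) (simp_all add: S.mult_eqs adj_counit_eqs algebra_simps)
  from pairing_adj[OF vsK this, of Y] show ?thesis
    unfolding pairing_def[symmetric]
    by (simp add: adj_counit_eq adj_proj_eqs adj_snd_eqs mult_zero counit_zero weak_counit
        pairing_def)
qed

theorem weak_bialgebra_adj: "weak_bialgebra S M adj_unit D E"
proof -
  interpret K: vector_space "(*) :: 'k \<Rightarrow> 'k \<Rightarrow> 'k" by (rule vector_space_field)
  have "Vector_Spaces.linear S (*) E"
    by unfold_locales (simp_all add: adj_counit_eqs)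
  then show ?thesis
    by (intro weak_bialgebra.intro weak_bialgebra_axioms.intro counital_coalgebra.intro
        counital_coalgebra_axioms.intro S.unital_algebra_axioms S.vector_space_axioms
        adj_comult_carrier D.comult_add D.comult_scale adj_coassoc adj_counit_left
        adj_counit_right adj_comult_mult adj_weak_unit_left adj_weak_unit_right adj_weak_counit)
qed

end


section \<open>Adjoining two unit elements to a bialgebra\<close>

context bialgebra
begin

text \<open>As \<open>\<Delta> u = u \<otimes> u\<close>, all three tensors in the axiom for \<open>\<Delta> u\<close> are \<open>u \<otimes> u \<otimes> u\<close>. By
  multiplicativity, the axiom for \<open>\<epsilon>\<close> reduces to \<open>\<epsilon> y = \<epsilon>(y\<^sub>(\<^sub>1\<^sub>)) \<epsilon>(y\<^sub>(\<^sub>2\<^sub>))\<close>, which is the counit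
  axiom with \<open>\<epsilon>\<close> applied to it.\<close>

lemma bialgebra_is_weak: "weak_bialgebra scale mult one \<Delta> \<epsilon>"
proof
  note vsK = vector_space_field[where 'k = 'k]
  show "\<Delta> (mult x y) = tmult2 scale mult (\<Delta> x) (\<Delta> y)" for x y
    by (rule comult_mult)
  show "comult_id scale \<Delta> (\<Delta> one) =
      tmult3 scale mult (tens_right scale (\<Delta> one) one) (tens_left scale one (\<Delta> one))"
  proof (rule tensor3_eqI[of _ scale])
    fix \<beta> :: "_ \<Rightarrow> _ \<Rightarrow> _ \<Rightarrow> 'k" assume \<beta>: "trilin scale (*) \<beta>"
    show "pairing (*) (\<lambda>(x, y, z). \<beta> x y z) (comult_id scale \<Delta> (\<Delta> one)) =
      pairing (*) (\<lambda>(x, y, z). \<beta> x y z)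
        (tmult3 scale mult (tens_right scale (\<Delta> one) one) (tens_left scale one (\<Delta> one)))"
      unfolding pairing_comult_id[OF vsK \<beta>] pairing_tens_right_left[OF vsK \<beta>]
        comult_one pairing_pure2[OF vsK bilin_weak_unit_left(2)[OF vsK \<beta>]]
        pairing_pure2[OF vsK bilin_pairing_comult(1)[OF vsK \<beta>]]
      by (simp add: comult_one
          pairing_pure2[OF vsK bilin_slice(1)[OF \<beta>]]
          pairing_pure2[OF vsK bilin_slice(2)[OF \<beta>]] mult_one_left)
  qed simp_all
  show "comult_id scale \<Delta> (\<Delta> one) =
      tmult3 scale mult (tens_left scale one (\<Delta> one)) (tens_right scale (\<Delta> one) one)"
  proof (rule tensor3_eqI[of _ scale])
    fix \<beta> :: "_ \<Rightarrow> _ \<Rightarrow> _ \<Rightarrow> 'k" assume \<beta>: "trilin scale (*) \<beta>"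
    show "pairing (*) (\<lambda>(x, y, z). \<beta> x y z) (comult_id scale \<Delta> (\<Delta> one)) =
      pairing (*) (\<lambda>(x, y, z). \<beta> x y z)
        (tmult3 scale mult (tens_left scale one (\<Delta> one)) (tens_right scale (\<Delta> one) one))"
      unfolding pairing_comult_id[OF vsK \<beta>] pairing_tens_left_right[OF vsK \<beta>]
        comult_one pairing_pure2[OF vsK bilin_weak_unit_right(2)[OF vsK \<beta>]]
        pairing_pure2[OF vsK bilin_pairing_comult(1)[OF vsK \<beta>]]
      by (simp add: comult_one
          pairing_pure2[OF vsK bilin_slice(1)[OF \<beta>]]
          pairing_pure2[OF vsK bilin_weak_unit_right(1)[OF vsK \<beta>]] mult_one_left)
  qed simp_all
  show "\<epsilon> (mult (mult x y) z) =
      lin_ext (*) (\<lambda>(p, q). \<epsilon> (mult x p) * \<epsilon> (mult q z)) (trep (\<Delta> y))" for x y z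
  proof -
    have "\<epsilon> y = \<epsilon> (counit_id scale \<epsilon> (\<Delta> y))" by (simp add: counit_left)
    also have "\<dots> = pairing (*) (\<lambda>(p, q). \<epsilon> p * \<epsilon> q) (\<Delta> y)"
      unfolding counit_id_def linear_lin_ext_commute[OF counit_linear]
      by (simp add: pairing_def case_prod_unfold counit_eqs)
    finally have "\<epsilon> (mult (mult x y) z) =
        (\<epsilon> x * \<epsilon> z) * pairing (*) (\<lambda>(p, q). \<epsilon> p * \<epsilon> q) (\<Delta> y)"
      by (simp add: counit_mult)
    also have "\<dots> = pairing (*) (\<lambda>(p, q). \<epsilon> (mult x p) * \<epsilon> (mult q z)) (\<Delta> y)"
      by (simp add: pairing_scale_right[OF vsK, symmetric] counit_mult mult_ac)
    finally show ?thesis by (simp add: pairing_def)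
  qed
qed

text \<open>The first step uses \<open>\<Delta> u = u \<otimes> u\<close>, so that \<open>\<Delta> e = (e - u) \<otimes> (e - u) + u \<otimes> u\<close>; the
  second adds \<open>(1 - e) \<otimes> (1 - e)\<close> to the value at the unit \<open>e\<close> obtained before.\<close>

lemma comult'_eq_adj_comult:
  "comult' scale one \<Delta> = adj_comult (adj_scale scale) adj_unit (adj_comult scale one \<Delta>)"
proof
  fix X :: "('v, 'k) adj2"
  note vsK = vector_space_field[where 'k = 'k]
  obtain b a c where X: "X = ((b, a), c)" by (metis surj_pair)
  have idem: "e' - incl' one = adj_incl (adj_idem one)" "one' - e' = adj_idem adj_unit"
    by (simp_all add: e'_def incl'_def one'_def adj_idem_def adj_incl_def adj_unit_def)
  show "comult' scale one \<Delta> X =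
      adj_comult (adj_scale scale) adj_unit (adj_comult scale one \<Delta>) X"
  proof (rule tensor2_eqI[of _ "scale' scale"])
    fix \<beta> :: "_ \<Rightarrow> _ \<Rightarrow> 'k" assume \<beta>: "bilin (scale' scale) (*) \<beta>"
    \<comment> \<open>the form, its restriction to the first extension, and its restriction to the bialgebra\<close>
    note \<beta>1 = \<beta>[unfolded scale'_def]
    note \<beta>2 = bilin_incl[OF \<beta>1]
    note \<beta>3 = bilin_incl[OF \<beta>2]
    show "pairing (*) (\<lambda>(x, y). \<beta> x y) (comult' scale one \<Delta> X) = pairing (*) (\<lambda>(x, y). \<beta> x y)
        (adj_comult (adj_scale scale) adj_unit (adj_comult scale one \<Delta>) X)"
      by (simp add: X comult'_def comult_one_def comult_e_def pairing_tadd[OF vsK \<beta>]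
          pairing_tscale[OF vsK \<beta>] pairing_tmap2[OF vsK \<beta>] pairing_pure2[OF vsK \<beta>] idem
          pairing_adj_comult[OF vsK \<beta>1])
        (simp add: adj_unit_def incl'_def pairing_adj_comult[OF vsK \<beta>2] comult_one
          pairing_pure2[OF vsK \<beta>3] pairing_comult_zero[OF vsK \<beta>3] algebra_simps)
  qed (simp_all add: X comult'_def adj_comult_def scale'_def)
qed

lemma counit'_eq_adj_counit: "counit' \<epsilon> = adj_counit (adj_counit \<epsilon> one) adj_unit"
  by (rule ext)
    (simp add: counit'_def adj_counit_def adj_unit_def case_prod_unfold counit_zero counit_one)

end

theorem proposition2p16:
  fixes scale :: "'k::{alg_closed_field, field_char_0} \<Rightarrow> 'b::ab_group_add \<Rightarrow> 'b"
    and mult :: "'b \<Rightarrow> 'b \<Rightarrow> 'b" and u :: 'b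
    and \<Delta> :: "'b \<Rightarrow> ('b \<times> 'b \<Rightarrow>\<^sub>0 'k) set" and \<epsilon> :: "'b \<Rightarrow> 'k"
  assumes "bialgebra scale mult u \<Delta> \<epsilon>"
  shows "weak_bialgebra (scale' scale) (mult' scale mult) one'
           (comult' scale u \<Delta>) (counit' \<epsilon>)"
proof -
  interpret bialgebra scale mult u \<Delta> \<epsilon> by (rule assms)
  show ?thesis
    unfolding scale'_def mult'_def one'_def comult'_eq_adj_comult counit'_eq_adj_counit
    by (intro weak_bialgebra.weak_bialgebra_adj bialgebra_is_weak)
qed

end
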